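(* Let $n\ge3$. Then there exists a zonoid $Z$ in $\mathbb{R}^n$ such that the Steiner polynomial $P_Z(t)=|Z+tB_2^n|$ and the polynomial $Q_Z(t)=|tZ+B_2^n|$ both have roots which are not real.
   Context: A zonotope is a finite Minkowski sum of segments; a zonoid is a Hausdorff limit of zonotopes (zonoids may have empty interior). $|\cdot|$ is $n$-dimensional volume, $+$ is Minkowski sum, $B_2^n$ is the closed Euclidean unit ball. For $t\ge0$ the functions $|Z+tB_2^n|$ and $|tZ+B_2^n|$ are polynomial in $t$; $P_Z$ and $Q_Z$ denote the corresponding polynomials, and roots are taken in $\mathbb{C}$. *)

theory Defs
  imports "HOL-Analysis.Analysis" "HOL-Computational_Algebra.Polynomial"
begin

(* Addition and sums of sets are Minkowski sums (HOL-Library.Set_Algebras).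
   Segments may be degenerate, and the sum with m = 0 is the single point 0. *)
definition zonotope :: "'a::euclidean_space set \<Rightarrow> bool" where
  "zonotope Z \<longleftrightarrow>
     (\<exists>(m::nat) (a::nat \<Rightarrow> 'a) (b::nat \<Rightarrow> 'a). Z = (\<Sum>i<m. closed_segment (a i) (b i)))"

(* Meaningful for nonempty bounded sets only: Sup on the reals is
   unspecified on sets that are empty or unbounded above. *)
definition hausdorff_dist :: "'a::metric_space set \<Rightarrow> 'a set \<Rightarrow> real" where
  "hausdorff_dist A B = max (SUP a\<in>A. infdist a B) (SUP b\<in>B. infdist b A)"

(* The limit is taken in the space of nonempty compact sets, where
   hausdorff_dist is a metric; zonotopes are nonempty and compact. *)
definition zonoid :: "'a::euclidean_space set \<Rightarrow> bool" where
  "zonoid Z \<longleftrightarrow> compact Z \<and> Z \<noteq> {} \<and>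
     (\<exists>X. (\<forall>k. zonotope (X k)) \<and> (\<lambda>k. hausdorff_dist (X k) Z) \<longlonglongrightarrow> 0)"

end

(* Z is the unit disc in a coordinate plane of R^n.  Fubini over the orthogonal complement of the
   plane gives, with k_i the volume of the unit ball in R^i,
     |rZ + tB| = k_n t^n + pi k_(n-1) r t^(n-1) + pi k_(n-2) r^2 t^(n-2),
   so up to a power of t both polynomials are quadratics whose discriminant has the sign of
   pi k_(n-1)^2 - 4 k_n k_(n-2).  That quantity vanishes for n = 2 and is negative for n >= 3.
   The disc is a zonoid because segments in equally spaced directions of a plane have a Minkowski
   sum whose support function is nearly constant. *)
theory Submission
  imports Defs
begin

section \<open>Volumes of unit balls and the sign of the discriminant\<close>

lemma unit_ball_vol_add_2:
  assumes "m = n + 2"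
  shows "unit_ball_vol (real m) = unit_ball_vol (real n) * (2 * pi / real m)"
proof -
  have "real n / 2 + 1 \<notin> \<int>\<^sub>\<le>\<^sub>0" by (auto elim!: nonpos_Ints_cases)
  then have "Gamma (real (n + 2) / 2 + 1) = (real n / 2 + 1) * Gamma (real n / 2 + 1)"
    using Gamma_plus1[of "real n / 2 + 1"] by (simp add: add_divide_distrib add_ac)
  moreover have "pi powr (real (n + 2) / 2) = pi * pi powr (real n / 2)"
    by (simp add: add_divide_distrib powr_add)
  moreover have "Gamma (real n / 2 + 1) \<noteq> 0"
    using Gamma_real_pos[of "real n / 2 + 1"] by linarith
  ultimately show ?thesis
    by (simp only: assms unit_ball_vol_def) (simp add: field_simps)
qed

text \<open>Machin's formula reads pi = 16 arctan(1/5) - 4 arctan(1/239), and arctan(1/5) is at most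
  1/5. The bound is sharp enough for the case n = 1 of the next lemma, which amounts to pi^2 <
  32/3.\<close>

lemma pi_less_16_5: "pi < 16 / 5"
proof -
  have "arctan (1 / 5) \<le> 1 / (5::real)" "arctan (1 / 239) > (0::real)"
    using arctan_le_self[of "1 / 5"] by simp_all
  then show ?thesis using machin by linarith
qed

text \<open>Induction in steps of two, because the recursion for the volumes links dimensions that
  differ by two; hence the two base cases. Passing from m to m + 2 multiplies the left side by 4
  pi^2 / (m+3)^2 and the right side by 4 pi^2 / ((m+4)(m+2)). The second factor is larger, since
  (m+4)(m+2) = (m+3)^2 - 1.\<close>

lemma pi_unit_ball_vol_square_less:
  assumes "n \<ge> 1"
  shows "pi * unit_ball_vol (real (n + 1))^2 < 4 * unit_ball_vol (real (n + 2)) * unit_ball_vol (real n)"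
  using assms
proof (induction n rule: less_induct)
  case (less n)
  let ?k = "\<lambda>m. unit_ball_vol (real m)"
  consider "n = 1" | "n = 2" | m where "n = m + 2" "m \<ge> 1"
  proof -
    have "n = 1 \<or> n = 2 \<or> n = (n - 2) + 2 \<and> n - 2 \<ge> 1" using less.prems by linarith
    then show thesis using that by blast
  qed
  then show ?case
  proof cases
    case 1
    then show ?thesis
      using mult_strict_mono[OF pi_less_16_5 pi_less_16_5]
      by (simp add: unit_ball_vol_2 unit_ball_vol_3 power2_eq_square)
  next
    case 2
    then show ?thesis
      by (simp add: unit_ball_vol_2 unit_ball_vol_3 unit_ball_vol_4 power2_eq_square)
  next
    case 3
    have IH: "pi * ?k (m + 1)^2 < 4 * ?k (m + 2) * ?k m"
      using 3 less.IH[of m] by simp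
    have r: "?k (m + 3) = ?k (m + 1) * (2 * pi / real (m + 3))"
      "?k (m + 4) = ?k (m + 2) * (2 * pi / real (m + 4))"
      "?k (m + 2) = ?k m * (2 * pi / real (m + 2))"
      by (rule unit_ball_vol_add_2; simp)+
    have "pi * ?k (m + 3)^2 = pi * ?k (m + 1)^2 * (4 * pi^2 / real (m + 3)^2)"
      unfolding r(1) by (simp add: power_mult_distrib power_divide)
    also have "\<dots> \<le> pi * ?k (m + 1)^2 * (4 * pi^2 / (real (m + 4) * real (m + 2)))"
    proof (intro mult_left_mono divide_left_mono)
      show "real (m + 4) * real (m + 2) \<le> real (m + 3)^2"
        by (simp add: power2_eq_square algebra_simps)
    qed auto
    also have "\<dots> < 4 * ?k (m + 2) * ?k m * (4 * pi^2 / (real (m + 4) * real (m + 2)))"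
      using IH by (intro mult_strict_right_mono) auto
    also have "\<dots> = 4 * (?k (m + 2) * (2 * pi / real (m + 4))) * (?k m * (2 * pi / real (m + 2)))"
      by (simp add: power2_eq_square)
    also have "\<dots> = 4 * ?k (m + 4) * ?k (m + 2)"
      by (simp only: r(2) flip: r(3))
    finally have "pi * ?k (m + 3)^2 < 4 * ?k (m + 4) * ?k (m + 2)" .
    moreover have "m + 2 + 1 = m + 3" "m + 2 + 2 = m + 4"
      by simp_all
    ultimately show ?thesis unfolding 3 by (simp only:)
  qed
qed

section \<open>Fubini for sets whose slices are balls\<close>

lemma emeasure_PiM_cball:
  assumes "finite A" "A \<noteq> {}" "r \<ge> 0"
  shows   "emeasure (Pi\<^sub>M A (\<lambda>_. lborel))
             {f \<in> space (Pi\<^sub>M A (\<lambda>_. lborel)). sqrt (\<Sum>i\<in>A. (f i)\<^sup>2) \<le> r} =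
             ennreal (unit_ball_vol (real (card A)) * r ^ card A)"
proof (cases "r = 0")
  case False
  then show ?thesis using emeasure_cball_aux[of A r] assms by (simp add: Int_def conj_commute)
next
  case True
  let ?M = "Pi\<^sub>M A (\<lambda>_. lborel :: real measure)"
  let ?S = "\<lambda>r. {f \<in> space ?M. sqrt (\<Sum>i\<in>A. (f i)\<^sup>2) \<le> r}"
  \<comment> \<open>Radius 0 is reached as a limit: the degenerate ball lies in every ball of radius
    \<open>r > 0\<close>, and the volumes of these tend to 0 because
    \<open>card A > 0\<close>.\<close>
  have *: "emeasure ?M (?S 0) \<le> ennreal (unit_ball_vol (real (card A)) * r ^ card A)" if "r > 0" for r
  proof -
    have "emeasure ?M (?S 0) \<le> emeasure ?M (?S r)"
      using that by (intro emeasure_mono) (auto intro: order_trans[of _ 0])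
    also have "\<dots> = ennreal (unit_ball_vol (real (card A)) * r ^ card A)"
      using emeasure_cball_aux[of A r] assms that by (simp add: Int_def conj_commute)
    finally show ?thesis .
  qed
  have c: "card A > 0" using assms by (simp add: card_gt_0_iff)
  have "((\<lambda>r. ennreal (unit_ball_vol (real (card A)) * r ^ card A)) \<longlongrightarrow> ennreal (unit_ball_vol (real (card A)) * 0 ^ card A)) (at_right 0)"
    by (intro tendsto_intros)
  then have "emeasure ?M (?S 0) \<le> ennreal (unit_ball_vol (real (card A)) * 0 ^ card A)"
    by (rule tendsto_lowerbound) (use * in \<open>auto simp: eventually_at_filter\<close>)
  moreover have "(0::real) ^ card A = 0" using c by (simp add: zero_power)
  ultimately show ?thesis using True by simp
qed

text \<open>Fubini over the \<open>J\<close> coordinates: the slice above \<open>x\<close> is a ball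
  in the \<open>I\<close> coordinates whose radius is the integrand's base. For
  \<open>\<rho> = 0\<close> the set is a round ball; a positive \<open>\<rho>\<close> adds a ball of
  radius \<open>\<rho>\<close> in the \<open>I\<close> directions.\<close>

lemma emeasure_PiM_fibred_cball:
  assumes "finite I" "finite J" "I \<inter> J = {}" "I \<noteq> {}" "\<rho> \<ge> 0"
  shows "emeasure (Pi\<^sub>M (J \<union> I) (\<lambda>_. lborel))
      {f \<in> space (Pi\<^sub>M (J \<union> I) (\<lambda>_. lborel)). sqrt (\<Sum>i\<in>J. (f i)\<^sup>2) \<le> t \<and>
          sqrt (\<Sum>i\<in>I. (f i)\<^sup>2) \<le> \<rho> + sqrt (t\<^sup>2 - (\<Sum>i\<in>J. (f i)\<^sup>2))} =
      (\<integral>\<^sup>+ x. ennreal (unit_ball_vol (card I) * (\<rho> + sqrt (t\<^sup>2 - (\<Sum>i\<in>J. (x i)\<^sup>2))) ^ card I)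
          * indicator {x. sqrt (\<Sum>i\<in>J. (x i)\<^sup>2) \<le> t} x \<partial>Pi\<^sub>M J (\<lambda>_. lborel))"
    (is "emeasure _ ?S = _")
proof -
  interpret product_sigma_finite "\<lambda>_. lborel :: real measure" by standard
  have comp: "(\<lambda>f. f i) \<in> borel_measurable (Pi\<^sub>M (J \<union> I) (\<lambda>_. lborel :: real measure))"
    if "i \<in> J \<union> I" for i
    using measurable_component_singleton[OF that, of "\<lambda>_. lborel"] by simp
  have sum: "(\<lambda>f. \<Sum>i\<in>K. (f i)\<^sup>2) \<in> borel_measurable (Pi\<^sub>M (J \<union> I) (\<lambda>_. lborel :: real measure))"
    if "K \<subseteq> J \<union> I" for K
    by (rule borel_measurable_sum, rule borel_measurable_power, rule comp) (use that in auto)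
  \<comment> \<open>Measurability is proved for arbitrary measurable \<open>g\<close> and
    \<open>h\<close>, to be instantiated with the two sums of squares.\<close>
  have "{f \<in> space M. sqrt (g f) \<le> t \<and> sqrt (h f) \<le> \<rho> + sqrt (t\<^sup>2 - g f)} \<in> sets M"
    if [measurable]: "g \<in> borel_measurable M" "h \<in> borel_measurable M" for g h :: "_ \<Rightarrow> real" and M
    by measurable
  from this[OF sum[OF Un_upper1] sum[OF Un_upper2]]
  have S: "?S \<in> sets (Pi\<^sub>M (J \<union> I) (\<lambda>_. lborel))" .
  have "emeasure (Pi\<^sub>M (J \<union> I) (\<lambda>_. lborel)) ?S = (\<integral>\<^sup>+ x. emeasure (Pi\<^sub>M I (\<lambda>_. lborel))
     ((\<lambda>y. merge J I (x, y)) -` ?S \<inter> space (Pi\<^sub>M I (\<lambda>_. lborel))) \<partial>Pi\<^sub>M J (\<lambda>_. lborel))"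
    using assms S by (intro emeasure_fold_integral) auto
  also have "\<dots> = (\<integral>\<^sup>+ x. ennreal (unit_ball_vol (card I) * (\<rho> + sqrt (t\<^sup>2 - (\<Sum>i\<in>J. (x i)\<^sup>2))) ^ card I)
          * indicator {x. sqrt (\<Sum>i\<in>J. (x i)\<^sup>2) \<le> t} x \<partial>Pi\<^sub>M J (\<lambda>_. lborel))"
  proof (intro nn_integral_cong)
    fix x assume x: "x \<in> space (Pi\<^sub>M J (\<lambda>_. lborel :: real measure))"
    let ?r = "\<rho> + sqrt (t\<^sup>2 - (\<Sum>i\<in>J. (x i)\<^sup>2))"
    have 1: "(\<Sum>i\<in>J. (merge J I (x, y) i)\<^sup>2) = (\<Sum>i\<in>J. (x i)\<^sup>2)" for y
      by (intro sum.cong) (auto simp: merge_def)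
    have 2: "(\<Sum>i\<in>I. (merge J I (x, y) i)\<^sup>2) = (\<Sum>i\<in>I. (y i)\<^sup>2)" for y
      using assms by (intro sum.cong) (auto simp: merge_def)
    have "merge J I (x, y) \<in> space (Pi\<^sub>M (J \<union> I) (\<lambda>_. lborel))" for y
      by (auto simp: space_PiM merge_def PiE_def extensional_def)
    then have "(\<lambda>y. merge J I (x, y)) -` ?S \<inter> space (Pi\<^sub>M I (\<lambda>_. lborel)) =
       {y \<in> space (Pi\<^sub>M I (\<lambda>_. lborel)). sqrt (\<Sum>i\<in>J. (x i)\<^sup>2) \<le> t \<and> sqrt (\<Sum>i\<in>I. (y i)\<^sup>2) \<le> ?r}"
      by (auto simp: 1 2)
    \<comment> \<open>Where the condition on \<open>x\<close> fails, the slice is empty and the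
      indicator is 0; where it holds, the radius is nonnegative and the ball formula
      applies.\<close>
    also have "emeasure (Pi\<^sub>M I (\<lambda>_. lborel)) \<dots> = ennreal (unit_ball_vol (card I) * ?r ^ card I)
        * indicator {x. sqrt (\<Sum>i\<in>J. (x i)\<^sup>2) \<le> t} x"
    proof (cases "sqrt (\<Sum>i\<in>J. (x i)\<^sup>2) \<le> t")
      case True
      have "?r \<ge> 0" using assms sqrt_le_D[OF True] by simp
      then show ?thesis using emeasure_PiM_cball[of I ?r] assms True by simp
    qed auto
    finally show "emeasure (Pi\<^sub>M I (\<lambda>_. lborel)) ((\<lambda>y. merge J I (x, y)) -` ?S \<inter> space (Pi\<^sub>M I (\<lambda>_. lborel)))
       = ennreal (unit_ball_vol (card I) * ?r ^ card I) * indicator {x. sqrt (\<Sum>i\<in>J. (x i)\<^sup>2) \<le> t} x" .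
  qed
  finally show ?thesis .
qed

text \<open>No integral is evaluated directly: for \<open>\<rho> = 0\<close> the fibred set is the
  full ball in the coordinates \<open>J \<union> I\<close>, whose volume is known, and the fibred
  formula is read backwards.\<close>

lemma nn_integral_PiM_cball_sqrt:
  assumes "finite I" "finite J" "I \<inter> J = {}" "I \<noteq> {}" "t \<ge> 0"
  shows "(\<integral>\<^sup>+ x. ennreal (unit_ball_vol (card I) * sqrt (t\<^sup>2 - (\<Sum>i\<in>J. (x i)\<^sup>2)) ^ card I)
          * indicator {x. sqrt (\<Sum>i\<in>J. (x i)\<^sup>2) \<le> t} x \<partial>Pi\<^sub>M J (\<lambda>_. lborel))
      = ennreal (unit_ball_vol (card I + card J) * t ^ (card I + card J))"
proof -
  have "{f \<in> space (Pi\<^sub>M (J \<union> I) (\<lambda>_. lborel)). sqrt (\<Sum>i\<in>J. (f i)\<^sup>2) \<le> t \<and>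
          sqrt (\<Sum>i\<in>I. (f i)\<^sup>2) \<le> 0 + sqrt (t\<^sup>2 - (\<Sum>i\<in>J. (f i)\<^sup>2))}
     = {f \<in> space (Pi\<^sub>M (J \<union> I) (\<lambda>_. lborel)). sqrt (\<Sum>i\<in>J \<union> I. (f i)\<^sup>2) \<le> t}"
  proof (intro Collect_cong conj_cong refl)
    fix f :: "'a \<Rightarrow> real"
    have p: "(\<Sum>i\<in>J. (f i)\<^sup>2) \<ge> 0" "(\<Sum>i\<in>I. (f i)\<^sup>2) \<ge> 0" by (auto intro: sum_nonneg)
    have "(\<Sum>i\<in>J \<union> I. (f i)\<^sup>2) = (\<Sum>i\<in>J. (f i)\<^sup>2) + (\<Sum>i\<in>I. (f i)\<^sup>2)"
      using assms by (intro sum.union_disjoint) auto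
    then show "(sqrt (\<Sum>i\<in>J. (f i)\<^sup>2) \<le> t \<and> sqrt (\<Sum>i\<in>I. (f i)\<^sup>2) \<le> 0 + sqrt (t\<^sup>2 - (\<Sum>i\<in>J. (f i)\<^sup>2)))
       \<longleftrightarrow> sqrt (\<Sum>i\<in>J \<union> I. (f i)\<^sup>2) \<le> t"
      using p assms by (auto simp: real_sqrt_le_iff')
  qed
  then show ?thesis
    using emeasure_PiM_fibred_cball[of I J 0 t] emeasure_PiM_cball[of "J \<union> I" t] assms
    by (simp add: card_Un_disjoint Int_commute add_ac)
qed

text \<open>The slices are planar discs of area \<open>pi * (\<rho> + s)^2\<close>. Expanding the
  square leaves the integrals of \<open>pi * s^2\<close>, \<open>2 * s\<close> and 1 over the
  \<open>J\<close> ball, which are the volumes of balls of radius \<open>t\<close> with two, one and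
  no coordinates added to \<open>J\<close>.\<close>

lemma emeasure_PiM_fibred_disc:
  assumes "finite J" "J \<noteq> {}" "a \<notin> J" "b \<notin> J" "a \<noteq> b" "\<rho> \<ge> 0" "t \<ge> 0"
  shows "emeasure (Pi\<^sub>M (J \<union> {a, b}) (\<lambda>_. lborel))
      {f \<in> space (Pi\<^sub>M (J \<union> {a, b}) (\<lambda>_. lborel)). sqrt (\<Sum>i\<in>J. (f i)\<^sup>2) \<le> t \<and>
          sqrt (\<Sum>i\<in>{a, b}. (f i)\<^sup>2) \<le> \<rho> + sqrt (t\<^sup>2 - (\<Sum>i\<in>J. (f i)\<^sup>2))} =
    ennreal (unit_ball_vol (card J + 2) * t ^ (card J + 2)
      + pi * unit_ball_vol (card J + 1) * \<rho> * t ^ (card J + 1)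
      + pi * unit_ball_vol (card J) * \<rho>\<^sup>2 * t ^ card J)"
proof -
  let ?M = "Pi\<^sub>M J (\<lambda>_. lborel :: real measure)"
  let ?s = "\<lambda>x. sqrt (t\<^sup>2 - (\<Sum>i\<in>J. (x i)\<^sup>2))"
  let ?B = "{x. sqrt (\<Sum>i\<in>J. (x i)\<^sup>2) \<le> t}"
  have i2: "(\<integral>\<^sup>+ x. ennreal (pi * ?s x ^ 2) * indicator ?B x \<partial>?M)
      = ennreal (unit_ball_vol (card J + 2) * t ^ (card J + 2))"
    using nn_integral_PiM_cball_sqrt[of "{a,b}" J t] assms by (simp add: unit_ball_vol_2 numeral_2_eq_2[symmetric])
  \<comment> \<open>The factor 2 is the length of the unit ball in dimension one, so this is the
    ball with the single extra coordinate \<open>a\<close>.\<close>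
  have i1: "(\<integral>\<^sup>+ x. ennreal (2 * ?s x) * indicator ?B x \<partial>?M)
      = ennreal (unit_ball_vol (card J + 1) * t ^ (card J + 1))"
    using nn_integral_PiM_cball_sqrt[of "{a}" J t] assms by simp
  have "(\<integral>\<^sup>+ x. indicator ?B x \<partial>?M) = (\<integral>\<^sup>+ x. indicator {f \<in> space ?M. sqrt (\<Sum>i\<in>J. (f i)\<^sup>2) \<le> t} x \<partial>?M)"
    by (intro nn_integral_cong) (auto simp: indicator_def)
  also have "\<dots> = ennreal (unit_ball_vol (card J) * t ^ card J)"
    using emeasure_PiM_cball[of J t] assms by (subst nn_integral_indicator) auto
  finally have i0: "(\<integral>\<^sup>+ x. indicator ?B x \<partial>?M) = ennreal (unit_ball_vol (card J) * t ^ card J)" .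
  have "emeasure (Pi\<^sub>M (J \<union> {a, b}) (\<lambda>_. lborel))
      {f \<in> space (Pi\<^sub>M (J \<union> {a, b}) (\<lambda>_. lborel)). sqrt (\<Sum>i\<in>J. (f i)\<^sup>2) \<le> t \<and>
          sqrt (\<Sum>i\<in>{a, b}. (f i)\<^sup>2) \<le> \<rho> + sqrt (t\<^sup>2 - (\<Sum>i\<in>J. (f i)\<^sup>2))} =
     (\<integral>\<^sup>+ x. ennreal (pi * (\<rho> + ?s x) ^ 2) * indicator ?B x \<partial>?M)"
    using emeasure_PiM_fibred_cball[of "{a,b}" J \<rho> t] assms by (simp add: unit_ball_vol_2 numeral_2_eq_2[symmetric])
  also have "\<dots> = (\<integral>\<^sup>+ x. (ennreal (pi * ?s x ^ 2) * indicator ?B x + ennreal (pi * \<rho>) * (ennreal (2 * ?s x) * indicator ?B x))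
       + ennreal (pi * \<rho>\<^sup>2) * indicator ?B x \<partial>?M)"
  proof (intro nn_integral_cong)
    fix x
    show "ennreal (pi * (\<rho> + ?s x) ^ 2) * indicator ?B x =
      (ennreal (pi * ?s x ^ 2) * indicator ?B x + ennreal (pi * \<rho>) * (ennreal (2 * ?s x) * indicator ?B x))
       + ennreal (pi * \<rho>\<^sup>2) * indicator ?B x"
    proof (cases "x \<in> ?B")
      case True
      then have "?s x \<ge> 0" using sqrt_le_D by auto
      with assms have "ennreal (pi * ?s x ^ 2) + ennreal (pi * \<rho>) * ennreal (2 * ?s x) + ennreal (pi * \<rho>\<^sup>2)
         = ennreal (pi * ?s x ^ 2 + (pi * \<rho>) * (2 * ?s x) + pi * \<rho>\<^sup>2)"
        by (subst ennreal_mult[symmetric], simp, simp, subst ennreal_plus[symmetric], simp, simp,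
            subst ennreal_plus[symmetric]) auto
      also have "pi * ?s x ^ 2 + (pi * \<rho>) * (2 * ?s x) + pi * \<rho>\<^sup>2 = pi * (\<rho> + ?s x) ^ 2"
        by (simp only: power2_sum) (simp add: algebra_simps)
      finally show ?thesis using True by simp
    qed auto
  qed
  also have "\<dots> = ennreal (unit_ball_vol (card J + 2) * t ^ (card J + 2))
      + ennreal (pi * \<rho>) * ennreal (unit_ball_vol (card J + 1) * t ^ (card J + 1))
      + ennreal (pi * \<rho>\<^sup>2) * ennreal (unit_ball_vol (card J) * t ^ card J)"
    by (subst nn_integral_add, measurable, subst nn_integral_add, measurable, subst nn_integral_cmult, measurable,
        subst nn_integral_cmult, measurable) (simp only: i0 i1 i2)
  also have "\<dots> = ennreal (unit_ball_vol (card J + 2) * t ^ (card J + 2)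
      + pi * unit_ball_vol (card J + 1) * \<rho> * t ^ (card J + 1)
      + pi * unit_ball_vol (card J) * \<rho>\<^sup>2 * t ^ card J)"
    using assms by (simp add: ennreal_plus[symmetric] ennreal_mult[symmetric] mult_ac del: ennreal_plus)
  finally show ?thesis .
qed

section \<open>Tools for approximating a disc by zonotopes\<close>

lemma zonotope_sum_closed_segment_eq:
  fixes c :: "nat \<Rightarrow> 'a::euclidean_space"
  shows "(\<Sum>j<N. closed_segment (- c j) (c j)) = {\<Sum>j<N. s j *\<^sub>R c j |s. \<forall>j<N. \<bar>s j\<bar> \<le> 1}"
proof -
  have seg: "closed_segment (- v) v = {s *\<^sub>R v |s. \<bar>s\<bar> \<le> 1}" for v :: 'a
  proof (intro set_eqI iffI)
    fix x assume "x \<in> closed_segment (- v) v"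
    then obtain u where u: "0 \<le> u" "u \<le> 1" "x = (1 - u) *\<^sub>R (- v) + u *\<^sub>R v"
      by (auto simp: in_segment)
    \<comment> \<open>The affine map from [0,1] onto [-1,1] turns the segment parameter into a
      signed coefficient.\<close>
    have "x = (2 * u - 1) *\<^sub>R v" unfolding u(3) by (simp add: algebra_simps flip: scaleR_2)
    with u show "x \<in> {s *\<^sub>R v |s. \<bar>s\<bar> \<le> 1}" by (auto intro!: exI[of _ "2 * u - 1"])
  next
    fix x assume "x \<in> {s *\<^sub>R v |s. \<bar>s\<bar> \<le> 1}"
    then obtain s where s: "\<bar>s\<bar> \<le> 1" "x = s *\<^sub>R v" by auto
    have "x = (1 - (1 + s) / 2) *\<^sub>R (- v) + ((1 + s) / 2) *\<^sub>R v"
      unfolding s(2) by (simp add: scaleR_left_distrib[symmetric] field_simps flip: scaleR_minus_left)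
    with s show "x \<in> closed_segment (- v) v"
      by (auto simp: in_segment intro!: exI[of _ "(1 + s) / 2"])
  qed
  show ?thesis
  proof (intro set_eqI iffI)
    fix x assume "x \<in> (\<Sum>j<N. closed_segment (- c j) (c j))"
    then obtain f where f: "x = sum f {..<N}" "\<forall>j<N. f j \<in> {s *\<^sub>R c j |s. \<bar>s\<bar> \<le> 1}"
      by (auto simp: set_sum_alt seg)
    then have "\<forall>j<N. \<exists>s. f j = s *\<^sub>R c j \<and> \<bar>s\<bar> \<le> 1" by auto
    then obtain s where "\<forall>j<N. f j = s j *\<^sub>R c j \<and> \<bar>s j\<bar> \<le> 1" by metis
    then show "x \<in> {\<Sum>j<N. s j *\<^sub>R c j |s. \<forall>j<N. \<bar>s j\<bar> \<le> 1}"
      using f(1) by (auto intro!: exI[of _ s] sum.cong)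
  next
    fix x assume "x \<in> {\<Sum>j<N. s j *\<^sub>R c j |s. \<forall>j<N. \<bar>s j\<bar> \<le> 1}"
    then obtain s where "x = (\<Sum>j<N. s j *\<^sub>R c j)" "\<forall>j<N. \<bar>s j\<bar> \<le> 1" by auto
    then show "x \<in> (\<Sum>j<N. closed_segment (- c j) (c j))"
      by (auto simp: set_sum_alt seg intro!: exI[of _ "\<lambda>j. s j *\<^sub>R c j"])
  qed
qed

text \<open>The uniform bound \<open>e\<close> makes the sets of distances bounded above, so both
  suprema are genuine. Nonnegativity is what a squeeze argument for convergence to 0 requires
  besides the upper bound.\<close>

lemma hausdorff_dist_bounds:
  assumes "A \<noteq> {}" "B \<noteq> {}"
    and AB: "\<And>a. a \<in> A \<Longrightarrow> infdist a B \<le> e" and BA: "\<And>b. b \<in> B \<Longrightarrow> infdist b A \<le> e"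
  shows "0 \<le> hausdorff_dist A B" "hausdorff_dist A B \<le> e"
proof -
  obtain a where a: "a \<in> A" using assms by auto
  have "infdist a B \<le> (SUP a\<in>A. infdist a B)"
    using AB by (intro cSUP_upper a) (auto simp: bdd_above_def)
  with infdist_nonneg[of a B] show "0 \<le> hausdorff_dist A B"
    unfolding hausdorff_dist_def by linarith
  show "hausdorff_dist A B \<le> e"
    unfolding hausdorff_dist_def using assms by (auto intro!: cSUP_least)
qed

text \<open>Up to scaling, the support function of the sum of \<open>N\<close> segments in the directions \<open>\<pi> j / N\<close>.\<close>

definition abs_cos_sum :: "nat \<Rightarrow> real \<Rightarrow> real" where
  "abs_cos_sum N \<phi> = (\<Sum>j<N. \<bar>cos (pi * real j / real N - \<phi>)\<bar>)"

text \<open>The oscillation bound below needs no value of the sum: the sum has period \<open>\<pi> / N\<close>, and each of its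
  \<open>N\<close> terms varies by at most \<open>\<pi> / N\<close> over one period.\<close>

lemma abs_cos_sum_shift:
  assumes "N > 0"
  shows "abs_cos_sum N (\<phi> + pi / real N) = abs_cos_sum N \<phi>"
proof -
  let ?f = "\<lambda>j. \<bar>cos (pi * (real j - 1) / real N - \<phi>)\<bar>"
  have "abs_cos_sum N (\<phi> + pi / real N) = (\<Sum>j<N. ?f j)"
    unfolding abs_cos_sum_def by (intro sum.cong refl arg_cong[of _ _ "\<lambda>x. \<bar>cos x\<bar>"]) (simp add: field_simps)
  \<comment> \<open>Shifting the angle by one period lowers the index by one. The arguments at the
    indices 0 and \<open>N\<close> differ by pi, and the absolute value of the cosine has period pi,
    so the end terms can be exchanged.\<close>
  also have "?f N = \<bar>cos (pi * (0 - 1) / real N - \<phi> + pi)\<bar>"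
    using assms by (intro arg_cong[of _ _ "\<lambda>x. \<bar>cos x\<bar>"]) (simp add: field_simps)
  then have "?f N = ?f 0" by simp
  then have "(\<Sum>j<N. ?f j) = (\<Sum>j<N. ?f (Suc j))"
    using sum.lessThan_Suc_shift[of ?f N] sum.lessThan_Suc[of ?f N] by linarith
  also have "\<dots> = abs_cos_sum N \<phi>"
    unfolding abs_cos_sum_def by simp
  finally show ?thesis .
qed

lemma abs_cos_sum_shift_of_int:
  assumes "N > 0"
  shows "abs_cos_sum N (\<phi> + of_int k * (pi / real N)) = abs_cos_sum N \<phi>"
proof (induction k rule: int_induct[where k = 0])
  case (step1 i)
  then show ?case using abs_cos_sum_shift[OF assms, of "\<phi> + of_int i * (pi / real N)"]
    by (simp only: of_int_add of_int_1 distrib_right mult_1 add.assoc)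
next
  case (step2 i)
  then show ?case using abs_cos_sum_shift[OF assms, of "\<phi> + of_int (i - 1) * (pi / real N)"]
    by (simp add: diff_divide_distrib algebra_simps)
qed auto

lemma abs_cos_diff_le: "\<bar>cos x - cos y\<bar> \<le> \<bar>x - y :: real\<bar>"
proof -
  have "\<bar>cos x - cos y\<bar> = 2 * \<bar>sin ((x + y) / 2)\<bar> * \<bar>sin ((y - x) / 2)\<bar>"
    by (simp add: cos_diff_cos abs_mult)
  also have "\<dots> \<le> 2 * 1 * \<bar>(y - x) / 2\<bar>"
    by (intro mult_mono abs_sin_x_le_abs_x) auto
  finally show ?thesis by simp
qed

lemma abs_cos_sum_oscillation:
  assumes "N > 0"
  shows "\<bar>abs_cos_sum N \<phi> - abs_cos_sum N \<psi>\<bar> \<le> pi"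
proof -
  define h where "h = pi / real N"
  have h: "h > 0" using assms by (simp add: h_def)
  \<comment> \<open>Moving \<open>\<psi>\<close> by \<open>k\<close> whole periods brings it within
    one period \<open>h\<close> of \<open>\<phi>\<close>.\<close>
  define k where "k = \<lfloor>(\<phi> - \<psi>) / h\<rfloor>"
  define \<psi>' where "\<psi>' = \<psi> + of_int k * h"
  have "of_int k \<le> (\<phi> - \<psi>) / h" "(\<phi> - \<psi>) / h < of_int k + 1"
    by (simp_all add: k_def)
  then have d: "\<bar>\<phi> - \<psi>'\<bar> \<le> h"
    using h by (simp add: \<psi>'_def field_simps)
  have "\<bar>abs_cos_sum N \<phi> - abs_cos_sum N \<psi>'\<bar>
      = \<bar>\<Sum>j<N. \<bar>cos (pi * real j / real N - \<phi>)\<bar> - \<bar>cos (pi * real j / real N - \<psi>')\<bar>\<bar>"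
    by (simp add: abs_cos_sum_def sum_subtractf)
  also have "\<dots> \<le> (\<Sum>j<N. h)"
  proof (intro sum_abs[THEN order_trans] sum_mono)
    fix j
    show "\<bar>\<bar>cos (pi * real j / real N - \<phi>)\<bar> - \<bar>cos (pi * real j / real N - \<psi>')\<bar>\<bar> \<le> h"
      using abs_cos_diff_le[of "pi * real j / real N - \<phi>" "pi * real j / real N - \<psi>'"] d by linarith
  qed
  also have "\<dots> = pi" using assms by (simp add: h_def)
  finally show ?thesis
    using abs_cos_sum_shift_of_int[OF assms, of \<psi> k] by (simp add: \<psi>'_def h_def)
qed

text \<open>Summing |cos x| + |sin x| >= 1 bounds \<open>N\<close> by the sum of the values at
  \<open>\<phi>\<close> and \<open>\<phi> + pi / 2\<close>, and these differ by at most pi. Linear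
  growth against bounded oscillation makes the relative oscillation tend to 0.\<close>

lemma abs_cos_sum_ge:
  assumes "N > 0"
  shows "2 * abs_cos_sum N \<phi> \<ge> real N - pi"
proof -
  have "\<bar>cos x\<bar> + \<bar>sin x\<bar> \<ge> (1::real)" for x
  proof -
    have "\<bar>cos x\<bar>^2 \<le> \<bar>cos x\<bar>" "\<bar>sin x\<bar>^2 \<le> \<bar>sin x\<bar>"
      using abs_cos_le_one[of x] abs_sin_le_one[of x]
      by (simp_all add: power2_eq_square mult_left_le del: power2_abs abs_mult_self_eq)
    then show ?thesis using sin_cos_squared_add[of x] unfolding power2_abs by linarith
  qed
  then have "(\<Sum>j<N. 1) \<le> (\<Sum>j<N. \<bar>cos (pi * real j / real N - \<phi>)\<bar> + \<bar>sin (pi * real j / real N - \<phi>)\<bar>)"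
    by (intro sum_mono)
  also have "\<dots> = abs_cos_sum N \<phi> + abs_cos_sum N (\<phi> + pi / 2)"
    by (simp add: abs_cos_sum_def sum.distrib cos_diff sin_diff cos_add sin_add algebra_simps)
  finally show ?thesis using abs_cos_sum_oscillation[OF assms, of "\<phi> + pi / 2" \<phi>] by auto
qed

section \<open>The unit disc of a plane as a zonoid\<close>

locale orthonormal_pair =
  fixes a b :: "'a::euclidean_space"
  assumes norm_a [simp]: "a \<bullet> a = 1" and norm_b [simp]: "b \<bullet> b = 1" and orth [simp]: "a \<bullet> b = 0" "b \<bullet> a = 0"
begin

definition dir :: "real \<Rightarrow> 'a" where "dir \<phi> = cos \<phi> *\<^sub>R a + sin \<phi> *\<^sub>R b"

definition disc :: "'a set" where "disc = cball 0 1 \<inter> span {a, b}"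

lemma inner_dir: "dir \<phi> \<bullet> dir \<psi> = cos (\<phi> - \<psi>)"
  by (simp add: dir_def inner_add_left inner_add_right cos_diff)

lemma norm_dir [simp]: "norm (dir \<phi>) = 1"
  by (simp add: norm_eq_1 inner_dir)

lemma dir_in_span: "dir \<phi> \<in> span {a, b}"
  unfolding dir_def by (intro span_add span_scale span_base) auto

lemma polar_span:
  assumes "x \<in> span {a, b}"
  obtains r \<phi> where "x = r *\<^sub>R dir \<phi>"
proof -
  obtain p q where "x = p *\<^sub>R a + q *\<^sub>R b"
    using assms by (auto simp: span_breakdown_eq algebra_simps)
  moreover obtain r \<phi> where "p = r * cos \<phi>" "q = r * sin \<phi>" using polar_Ex by blast
  ultimately show ?thesis by (intro that[of r \<phi>]) (simp add: dir_def algebra_simps)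
qed

lemma zero_in_disc: "0 \<in> disc"
  by (simp add: disc_def span_zero)

lemma compact_disc: "compact disc"
  unfolding disc_def by (intro compact_Int_closed compact_cball closed_span)

text \<open>A normalised sum \<open>X\<close> of segments in equally spaced directions has a support
  function within \<open>\<epsilon>\<close> of 1 throughout the plane. The upper bound confines
  \<open>X\<close> to the disc of radius \<open>1 + \<epsilon>\<close>; both bounds together give a
  point of \<open>X\<close> near each point of the unit circle, and scaling reaches the rest of the
  disc.\<close>

lemma zonotope_near_disc:
  assumes "e > 0"
  shows "\<exists>X. zonotope X \<and> 0 \<le> hausdorff_dist X disc \<and> hausdorff_dist X disc \<le> e"
proof -
  \<comment> \<open>The first entry serves the distance from \<open>X\<close> to the disc; the
    second yields \<open>4 * \<epsilon> + \<epsilon>^2 \<le> e^2\<close>, the squared distance bound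
    that arises for points of the unit circle.\<close>
  define \<epsilon> where "\<epsilon> = min e (e\<^sup>2 / (4 + e))"
  have \<epsilon>: "\<epsilon> > 0" "\<epsilon> \<le> e" using assms by (auto simp: \<epsilon>_def)
  have "4 * \<epsilon> + \<epsilon>\<^sup>2 = (4 + \<epsilon>) * \<epsilon>" by (simp add: power2_eq_square algebra_simps)
  also have "\<dots> \<le> (4 + e) * (e\<^sup>2 / (4 + e))" using \<epsilon> assms by (intro mult_mono) (auto simp: \<epsilon>_def)
  finally have \<epsilon>2: "4 * \<epsilon> + \<epsilon>\<^sup>2 \<le> e\<^sup>2" using assms by simp
  \<comment> \<open>With the lower bound \<open>2 * G \<ge> real N - pi\<close>, this size of
    \<open>N\<close> forces \<open>G > pi / \<epsilon>\<close>, so the oscillation pi falls below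
    \<open>\<epsilon>\<close> after division by \<open>G\<close>.\<close>
  obtain N :: nat where N: "real N > pi + 2 * pi / \<epsilon>" using reals_Archimedean2 by blast
  have "2 * pi / \<epsilon> > 0" using \<epsilon> by simp
  then have N0: "N > 0" using N pi_gt_zero by (cases N) auto
  define G where "G = abs_cos_sum N 0"
  have "2 * G > 2 * pi / \<epsilon>" using abs_cos_sum_ge[OF N0, of 0] N by (simp add: G_def)
  then have G\<epsilon>: "G * \<epsilon> > pi" using \<epsilon> by (simp add: field_simps)
  then have G: "G > 0" using \<epsilon> pi_gt_zero by (metis less_trans zero_less_mult_pos2)
  define c where "c j = (1 / G) *\<^sub>R dir (pi * real j / real N)" for j
  define X where "X = (\<Sum>j<N. closed_segment (- c j) (c j))"
  have support: "\<bar>(\<Sum>j<N. \<bar>c j \<bullet> dir \<phi>\<bar>) - 1\<bar> \<le> \<epsilon>" for \<phi>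
  proof -
    have "(\<Sum>j<N. \<bar>c j \<bullet> dir \<phi>\<bar>) = abs_cos_sum N \<phi> / G"
      using G by (simp add: c_def inner_dir abs_cos_sum_def sum_divide_distrib abs_mult)
    then have "(\<Sum>j<N. \<bar>c j \<bullet> dir \<phi>\<bar>) - 1 = (abs_cos_sum N \<phi> - G) / G"
      using G by (simp add: diff_divide_distrib)
    then have "\<bar>(\<Sum>j<N. \<bar>c j \<bullet> dir \<phi>\<bar>) - 1\<bar> = \<bar>abs_cos_sum N \<phi> - G\<bar> / G"
      using G by simp
    also have "\<dots> \<le> pi / G" using abs_cos_sum_oscillation[OF N0, of \<phi> 0] G by (intro divide_right_mono) (auto simp: G_def)
    also have "\<dots> \<le> \<epsilon>" using G\<epsilon> G by (simp add: field_simps)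
    finally show ?thesis .
  qed
  \<comment> \<open>Testing \<open>x\<close> against its own direction turns the bound on the
    support function into a bound on the norm.\<close>
  have norm_le: "norm x \<le> 1 + \<epsilon>" if x: "x = (\<Sum>j<N. s j *\<^sub>R c j)" and s: "\<forall>j<N. \<bar>s j\<bar> \<le> 1" for x s
  proof -
    have "x \<in> span {a, b}"
      unfolding x c_def by (intro span_sum span_scale dir_in_span)
    then obtain r \<phi> where r: "x = r *\<^sub>R dir \<phi>" by (rule polar_span)
    have "norm x = \<bar>x \<bullet> dir \<phi>\<bar>" using inner_dir[of \<phi> \<phi>] by (simp add: r)
    also have "\<dots> = \<bar>\<Sum>j<N. s j * (c j \<bullet> dir \<phi>)\<bar>" by (simp add: x inner_sum_left)
    also have "\<dots> \<le> (\<Sum>j<N. 1 * \<bar>c j \<bullet> dir \<phi>\<bar>)"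
      using s by (intro sum_abs[THEN order_trans] sum_mono) (auto simp: abs_mult intro!: mult_right_mono mult_left_le_one_le)
    also have "\<dots> \<le> 1 + \<epsilon>" using support[of \<phi>] by simp
    finally show ?thesis .
  qed
  have X_eq: "X = {\<Sum>j<N. s j *\<^sub>R c j |s. \<forall>j<N. \<bar>s j\<bar> \<le> 1}"
    unfolding X_def by (rule zonotope_sum_closed_segment_eq)
  have near_disc: "infdist x disc \<le> e" if x: "x \<in> X" for x
  proof -
    obtain s where s: "x = (\<Sum>j<N. s j *\<^sub>R c j)" "\<forall>j<N. \<bar>s j\<bar> \<le> 1" using x unfolding X_eq by blast
    have n: "norm x \<le> 1 + \<epsilon>" by (rule norm_le[OF s])
    \<comment> \<open>Shrinking by \<open>1 + \<epsilon>\<close> moves \<open>x\<close> into the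
      disc and displaces it by at most \<open>\<epsilon>\<close>.\<close>
    let ?y = "(1 / (1 + \<epsilon>)) *\<^sub>R x"
    have "x \<in> span {a, b}"
      unfolding s(1) c_def by (intro span_sum span_scale dir_in_span)
    then have y: "?y \<in> disc" using n \<epsilon> by (auto simp: disc_def intro: span_scale)
    have "1 / (1 + \<epsilon>) + \<epsilon> / (1 + \<epsilon>) = 1" using \<epsilon> by (simp add: field_simps)
    then have "?y + (\<epsilon> / (1 + \<epsilon>)) *\<^sub>R x = x" by (simp flip: scaleR_left_distrib)
    then have "x - ?y = (\<epsilon> / (1 + \<epsilon>)) *\<^sub>R x" by (simp add: algebra_simps)
    then have "dist x ?y = \<epsilon> / (1 + \<epsilon>) * norm x" using \<epsilon> by (simp add: dist_norm)
    also have "\<dots> \<le> \<epsilon> / (1 + \<epsilon>) * (1 + \<epsilon>)" using n \<epsilon> by (intro mult_left_mono) auto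
    also have "\<dots> \<le> e" using \<epsilon> by simp
    finally show ?thesis using infdist_le[OF y, of x] by linarith
  qed
  have near_X: "infdist x X \<le> e" if x: "x \<in> disc" for x
  proof -
    obtain r \<phi> where r: "x = r *\<^sub>R dir \<phi>" using polar_span x by (auto simp: disc_def)
    have r1: "\<bar>r\<bar> \<le> 1" using x by (simp add: disc_def r)
    \<comment> \<open>These signs maximise the inner product with \<open>dir \<phi>\<close> over \<open>X\<close>.\<close>
    let ?s = "\<lambda>j. sgn (c j \<bullet> dir \<phi>)"
    define y where "y = (\<Sum>j<N. ?s j *\<^sub>R c j)"
    have n: "norm y \<le> 1 + \<epsilon>" by (rule norm_le[OF y_def]) (auto simp: sgn_if)
    have "y \<bullet> dir \<phi> = (\<Sum>j<N. \<bar>c j \<bullet> dir \<phi>\<bar>)"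
      by (simp add: y_def inner_sum_left abs_sgn mult.commute)
    then have i: "y \<bullet> dir \<phi> \<ge> 1 - \<epsilon>" using support[of \<phi>] by simp
    \<comment> \<open>A vector of norm at most \<open>1 + \<epsilon>\<close> whose inner product
      with the unit vector \<open>dir \<phi>\<close> is at least \<open>1 - \<epsilon>\<close> has
      to be close to it.\<close>
    have "(norm (dir \<phi> - y))\<^sup>2 = 1 - 2 * (y \<bullet> dir \<phi>) + (norm y)\<^sup>2"
      by (simp add: power2_norm_eq_inner inner_diff_left inner_diff_right inner_commute inner_dir)
    also have "\<dots> \<le> 1 - 2 * (1 - \<epsilon>) + (1 + \<epsilon>)\<^sup>2"
      using i n by (intro add_mono power_mono) auto
    also have "\<dots> = 4 * \<epsilon> + \<epsilon>\<^sup>2" by (simp add: power2_eq_square algebra_simps)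
    finally have "(norm (dir \<phi> - y))\<^sup>2 \<le> e\<^sup>2" using \<epsilon>2 by linarith
    then have d: "norm (dir \<phi> - y) \<le> e" using assms by (simp add: power2_le_iff_abs_le)
    \<comment> \<open>Scaling by \<open>r\<close>, of either sign, keeps all coefficients in [-1,1],
      so the multiple of \<open>y\<close> stays in \<open>X\<close>.\<close>
    have "r *\<^sub>R y = (\<Sum>j<N. (r * ?s j) *\<^sub>R c j)" by (simp add: y_def scaleR_sum_right)
    moreover have "\<forall>j<N. \<bar>r * ?s j\<bar> \<le> 1" using r1 by (auto simp: sgn_if)
    ultimately have X: "r *\<^sub>R y \<in> X" unfolding X_eq
      by (intro CollectI exI[of _ "\<lambda>j. r * ?s j"] conjI)
    have "dist x (r *\<^sub>R y) = \<bar>r\<bar> * norm (dir \<phi> - y)" by (simp add: r dist_norm flip: scaleR_diff_right)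
    also have "\<dots> \<le> 1 * e" using r1 d by (intro mult_mono) auto
    finally show ?thesis using infdist_le[OF X, of x] by linarith
  qed
  have "X \<noteq> {}" by (auto simp: X_eq intro!: exI[of _ "\<lambda>_. 0"])
  moreover have "disc \<noteq> {}" using zero_in_disc by blast
  moreover have "zonotope X" unfolding zonotope_def X_def
    by (intro exI[of _ N] exI[of _ "\<lambda>j. - c j"] exI[of _ c]) (rule refl)
  ultimately show ?thesis using hausdorff_dist_bounds[of X disc e] near_disc near_X by blast
qed

lemma zonoid_disc: "zonoid disc"
proof -
  have "\<exists>X. \<forall>k. zonotope (X k) \<and> 0 \<le> hausdorff_dist (X k) disc \<and> hausdorff_dist (X k) disc \<le> inverse (real (Suc k))"
    by (intro choice allI zonotope_near_disc) simp
  then obtain X where X: "\<And>k. zonotope (X k)" "\<And>k. 0 \<le> hausdorff_dist (X k) disc"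
      "\<And>k. hausdorff_dist (X k) disc \<le> inverse (real (Suc k))" by blast
  have "(\<lambda>k. hausdorff_dist (X k) disc) \<longlonglongrightarrow> 0"
    by (rule tendsto_sandwich[OF _ _ tendsto_const LIMSEQ_inverse_real_of_nat]) (auto simp: X simp del: of_nat_Suc intro!: always_eventually)
  moreover have "disc \<noteq> {}" using zero_in_disc by blast
  ultimately show ?thesis using X(1) compact_disc unfolding zonoid_def by blast
qed

end

section \<open>The volume of a scaled disc plus a ball\<close>

context orthonormal_pair
begin

definition proj :: "'a \<Rightarrow> 'a" where "proj x = (x \<bullet> a) *\<^sub>R a + (x \<bullet> b) *\<^sub>R b"

lemma proj_in_span: "proj x \<in> span {a, b}"
  unfolding proj_def by (intro span_add span_scale span_base) auto

lemma proj_id: "x \<in> span {a, b} \<Longrightarrow> proj x = x"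
  by (erule polar_span) (simp add: proj_def dir_def inner_add_left algebra_simps)

lemma proj_add: "proj (x + y) = proj x + proj y"
  by (simp add: proj_def inner_add_left algebra_simps)

lemma norm_add_proj:
  assumes "p \<in> span {a, b}"
  shows "(norm (p + (x - proj x)))\<^sup>2 = (norm p)\<^sup>2 + (norm (x - proj x))\<^sup>2"
proof -
  obtain r \<phi> where "p = r *\<^sub>R dir \<phi>" using assms by (rule polar_span)
  then have "orthogonal p (x - proj x)"
    by (simp add: orthogonal_def proj_def dir_def inner_add_left inner_add_right inner_diff_right inner_commute)
  then show ?thesis by (rule norm_add_Pythagorean)
qed

text \<open>By Pythagoras, a ball summand that supplies the component w orthogonal to the plane has
  at most sqrt(t^2 - |w|^2) left inside the plane, to which the disc adds at most \<open>r\<close>.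
  Conversely, the point of the scaled disc nearest to \<open>proj x\<close> serves as the disc
  summand.\<close>

lemma disc_plus_cball_iff:
  assumes "r \<ge> 0" "t \<ge> 0"
  shows "x \<in> (*\<^sub>R) r ` disc + cball 0 t \<longleftrightarrow>
    norm (x - proj x) \<le> t \<and> norm (proj x) \<le> r + sqrt (t\<^sup>2 - (norm (x - proj x))\<^sup>2)"
proof
  assume "x \<in> (*\<^sub>R) r ` disc + cball 0 t"
  then obtain d c where dc: "d \<in> disc" "norm c \<le> t" "x = r *\<^sub>R d + c"
    by (auto elim!: set_plus_elim)
  have rd: "r *\<^sub>R d \<in> span {a, b}" using dc(1) by (auto simp: disc_def intro: span_scale)
  have px: "proj x = r *\<^sub>R d + proj c" using proj_id[OF rd] by (simp add: dc(3) proj_add)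
  then have w: "x - proj x = c - proj c" by (simp add: dc(3))
  have "(norm (proj c))\<^sup>2 + (norm (c - proj c))\<^sup>2 = (norm c)\<^sup>2"
    using norm_add_proj[OF proj_in_span, of c c] by simp
  also have "\<dots> \<le> t\<^sup>2" using dc(2) by (intro power_mono) auto
  finally have *: "(norm (proj c))\<^sup>2 + (norm (c - proj c))\<^sup>2 \<le> t\<^sup>2" .
  then have "(norm (c - proj c))\<^sup>2 \<le> t\<^sup>2" using zero_le_power2[of "norm (proj c)"] by linarith
  then have 1: "norm (c - proj c) \<le> t" using assms(2) by (rule power2_le_imp_le)
  have "norm (proj x) \<le> norm (r *\<^sub>R d) + norm (proj c)" unfolding px by (rule norm_triangle_ineq)
  also have "norm (r *\<^sub>R d) \<le> r" using dc(1) assms by (auto simp: disc_def intro: mult_left_le)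
  also have "norm (proj c) \<le> sqrt (t\<^sup>2 - (norm (c - proj c))\<^sup>2)"
    using * by (intro real_le_rsqrt) simp
  finally show "norm (x - proj x) \<le> t \<and> norm (proj x) \<le> r + sqrt (t\<^sup>2 - (norm (x - proj x))\<^sup>2)"
    using 1 w by simp
next
  assume x: "norm (x - proj x) \<le> t \<and> norm (proj x) \<le> r + sqrt (t\<^sup>2 - (norm (x - proj x))\<^sup>2)"
  show "x \<in> (*\<^sub>R) r ` disc + cball 0 t"
  \<comment> \<open>If \<open>proj x\<close> lies in the scaled disc it is itself the disc summand;
    otherwise the summand is the boundary point in the same direction.\<close>
  proof (cases "norm (proj x) \<le> r")
    case True
    have "proj x \<in> (*\<^sub>R) r ` disc"
    proof (cases "r = 0")
      case True
      with \<open>norm (proj x) \<le> r\<close> zero_in_disc show ?thesis by (auto intro: image_eqI[of _ _ 0])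
    next
      case False
      then have "(1 / r) *\<^sub>R proj x \<in> disc"
        using \<open>norm (proj x) \<le> r\<close> assms by (auto simp: disc_def field_simps intro: span_scale proj_in_span)
      with False show ?thesis by (intro image_eqI[of _ _ "(1 / r) *\<^sub>R proj x"]) auto
    qed
    then have "proj x + (x - proj x) \<in> (*\<^sub>R) r ` disc + cball 0 t"
      using x by (intro set_plus_intro) auto
    then show ?thesis by simp
  next
    case False
    define d where "d = (1 / norm (proj x)) *\<^sub>R proj x"
    define l where "l = norm (proj x)"
    have l: "l > r" "l > 0" using False assms by (auto simp: l_def)
    have d: "d \<in> disc" using l by (auto simp: d_def disc_def l_def intro: span_scale proj_in_span)
    have "proj x = l *\<^sub>R d" using l by (simp add: d_def l_def)
    then have e: "x - r *\<^sub>R d = (l - r) *\<^sub>R d + (x - proj x)" by (simp add: algebra_simps)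
    have nd: "norm d = 1" using l by (simp add: d_def l_def)
    have "(l - r) *\<^sub>R d \<in> span {a, b}" using d by (auto simp: disc_def intro: span_scale)
    then have "(norm (x - r *\<^sub>R d))\<^sup>2 = (l - r)\<^sup>2 + (norm (x - proj x))\<^sup>2"
      unfolding e using nd by (subst norm_add_proj) auto
    moreover have "(l - r)\<^sup>2 \<le> (sqrt (t\<^sup>2 - (norm (x - proj x))\<^sup>2))\<^sup>2"
      using x l by (intro power_mono) (auto simp: l_def)
    moreover have "(norm (x - proj x))\<^sup>2 \<le> t\<^sup>2" using x by (intro power_mono) auto
    ultimately have "(norm (x - r *\<^sub>R d))\<^sup>2 \<le> t\<^sup>2" by simp
    then have "norm (x - r *\<^sub>R d) \<le> t" using assms(2) by (rule power2_le_imp_le)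
    then have "r *\<^sub>R d + (x - r *\<^sub>R d) \<in> (*\<^sub>R) r ` disc + cball 0 t"
      using d by (intro set_plus_intro) auto
    then show ?thesis by simp
  qed
qed

text \<open>In coordinates the membership criterion describes the fibred set over \<open>J\<close>,
  the basis vectors other than \<open>a\<close> and \<open>b\<close>. The condition
  \<open>m > 0\<close> makes \<open>J\<close> nonempty, as the fibred formula requires.\<close>

lemma measure_disc_plus_cball:
  assumes basis: "a \<in> Basis" "b \<in> Basis" and dim: "DIM('a) = m + 2" "m > 0" and rt: "r \<ge> 0" "t \<ge> 0"
  shows "measure lebesgue ((*\<^sub>R) r ` disc + cball 0 t) =
    unit_ball_vol (m + 2) * t ^ (m + 2) + pi * unit_ball_vol (m + 1) * r * t ^ (m + 1)
      + pi * unit_ball_vol m * r\<^sup>2 * t ^ m"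
proof -
  define J where "J = Basis - {a, b}"
  have ab: "a \<noteq> b" using orth(1) norm_a by force
  have J: "finite J" "a \<notin> J" "b \<notin> J" "J \<union> {a, b} = Basis" using basis by (auto simp: J_def)
  have "card J + 2 = m + 2"
    using dim(1) J ab card_Un_disjoint[of J "{a, b}"] by simp
  then have m: "card J = m" by simp
  then have "J \<noteq> {}" using dim by auto
  let ?S = "(*\<^sub>R) r ` disc + cball 0 t"
  let ?x = "\<lambda>f. \<Sum>i\<in>Basis. f i *\<^sub>R i :: 'a"
  have "compact ?S"
    unfolding set_plus_def using compact_sums'[OF compact_scaling[OF compact_disc, of r] compact_cball[of 0 t]]
    by (rule back_subst[of compact]) blast
  then have S: "?S \<in> sets borel" by (simp add: borel_compact)
  have proj: "norm (proj (?x f)) = sqrt (\<Sum>i\<in>{a, b}. (f i)\<^sup>2)"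
    "norm (?x f - proj (?x f)) = sqrt (\<Sum>i\<in>J. (f i)\<^sup>2)" for f
  proof -
    have p: "proj (?x f) = f a *\<^sub>R a + f b *\<^sub>R b"
      using basis by (simp add: proj_def)
    have "(norm (proj (?x f)))\<^sup>2 = (f a)\<^sup>2 + (f b)\<^sup>2"
      unfolding p power2_norm_eq_inner by (simp add: inner_add_left inner_add_right power2_eq_square)
    then have "sqrt ((f a)\<^sup>2 + (f b)\<^sup>2) = norm (proj (?x f))"
      by (intro real_sqrt_unique) auto
    then show "norm (proj (?x f)) = sqrt (\<Sum>i\<in>{a, b}. (f i)\<^sup>2)"
      using ab by simp
    have "?x f = (\<Sum>i\<in>J. f i *\<^sub>R i) + (\<Sum>i\<in>{a, b}. f i *\<^sub>R i)"
      using J by (subst J(4)[symmetric], intro sum.union_disjoint) auto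
    then have "?x f - proj (?x f) = (\<Sum>i\<in>J. f i *\<^sub>R i)"
      unfolding p using ab by simp
    then have "(norm (?x f - proj (?x f)))\<^sup>2 = (\<Sum>i\<in>J. (f i)\<^sup>2)"
      using J(1) norm_sum_Pythagorean[of J "\<lambda>i. f i *\<^sub>R i"]
      by (auto simp: pairwise_def orthogonal_def J_def inner_not_same_Basis)
    then have "sqrt (\<Sum>i\<in>J. (f i)\<^sup>2) = norm (?x f - proj (?x f))"
      by (intro real_sqrt_unique norm_ge_zero)
    then show "norm (?x f - proj (?x f)) = sqrt (\<Sum>i\<in>J. (f i)\<^sup>2)" ..
  qed
  \<comment> \<open>The compact set \<open>?S\<close> is Borel, so its Lebesgue measure is that of
    its preimage under the coordinate map \<open>?x\<close> from the product measure.\<close>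
  have "emeasure lebesgue ?S = emeasure lborel ?S"
    using S by simp
  also have "\<dots> = emeasure (distr (Pi\<^sub>M Basis (\<lambda>_. lborel)) borel ?x) ?S"
    by (simp only: lborel_eq[symmetric])
  also have "\<dots> = emeasure (Pi\<^sub>M Basis (\<lambda>_. lborel)) (?x -` ?S \<inter> space (Pi\<^sub>M Basis (\<lambda>_. lborel)))"
    by (rule emeasure_distr) (use S in simp_all)
  also have "?x -` ?S \<inter> space (Pi\<^sub>M Basis (\<lambda>_. lborel)) =
     {f \<in> space (Pi\<^sub>M (J \<union> {a, b}) (\<lambda>_. lborel)). sqrt (\<Sum>i\<in>J. (f i)\<^sup>2) \<le> t \<and>
          sqrt (\<Sum>i\<in>{a, b}. (f i)\<^sup>2) \<le> r + sqrt (t\<^sup>2 - (\<Sum>i\<in>J. (f i)\<^sup>2))}"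
    unfolding J(4) using disc_plus_cball_iff[OF rt]
    by (auto simp only: vimage_def Int_def mem_Collect_eq proj real_sqrt_pow2 sum_nonneg zero_le_power2)
  also have "emeasure (Pi\<^sub>M Basis (\<lambda>_. lborel)) \<dots> =
     ennreal (unit_ball_vol (m + 2) * t ^ (m + 2) + pi * unit_ball_vol (m + 1) * r * t ^ (m + 1)
      + pi * unit_ball_vol m * r\<^sup>2 * t ^ m)"
    using emeasure_PiM_fibred_disc[OF J(1) \<open>J \<noteq> {}\<close> J(2,3) ab rt] unfolding m J(4) .
  finally show ?thesis
    using rt by (intro measure_eq_emeasure_eq_ennreal) auto
qed

end

section \<open>Nonreal roots of real quadratics, and the two polynomials of the disc\<close>

lemma poly_pCons_0_funpow: "poly ((pCons 0 ^^ m) p) x = x ^ m * poly p x"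
  for x :: "'a::comm_semiring_1"
  by (induction m) (simp_all add: mult.assoc)

lemma map_poly_pCons_0_funpow: "f 0 = 0 \<Longrightarrow> map_poly f ((pCons 0 ^^ m) p) = (pCons 0 ^^ m) (map_poly f p)"
  by (induction m) (simp_all add: map_poly_pCons)

lemma nonreal_root_quadratic:
  fixes a b c :: real
  assumes "b\<^sup>2 < 4 * a * c"
  obtains z where "poly (map_poly complex_of_real [:c, b, a:]) z = 0" "z \<notin> \<real>"
proof -
  have a: "a \<noteq> 0" using assms zero_le_power2[of b] by auto
  define s where "s = sqrt (4 * a * c - b\<^sup>2)"
  have s: "s > 0" "s\<^sup>2 = 4 * a * c - b\<^sup>2" using assms by (auto simp: s_def)
  \<comment> \<open>This is the quadratic formula with \<open>s\<close> the root of the negated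
    discriminant; the imaginary part is nonzero because \<open>s > 0\<close>.\<close>
  define z where "z = Complex (- b / (2 * a)) (s / (2 * a))"
  \<comment> \<open>This is the real part of the equation for \<open>z\<close>; the imaginary part
    cancels because the real part of \<open>z\<close> is \<open>- b / (2 * a)\<close>.\<close>
  have "c + ((- b / (2 * a)) * b + ((- b / (2 * a))\<^sup>2 - (s / (2 * a))\<^sup>2) * a) = 0"
    unfolding power_divide s(2) using a by (simp add: field_simps power2_eq_square)
  then have "poly (map_poly complex_of_real [:c, b, a:]) z = 0"
    using a by (simp add: map_poly_pCons z_def complex_eq_iff power2_eq_square algebra_simps)
  moreover have "z \<notin> \<real>" using s a by (simp add: z_def complex_is_Real_iff)
  ultimately show ?thesis by (rule that)
qed

lemma scaleR_image_cball_0_1: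
  assumes "t \<ge> 0"
  shows "(*\<^sub>R) t ` cball 0 1 = cball (0 :: 'a::real_normed_vector) t"
proof (cases "t = 0")
  case True
  then show ?thesis by (auto intro: image_eqI[of _ _ 0])
next
  case False
  then show ?thesis using cball_scale[of t "0 :: 'a" 1] assms by simp
qed

theorem proposition5p7:
  assumes "CARD('n::finite) \<ge> 3"
  shows "\<exists>(Z :: (real ^ 'n) set) (P :: real poly) (Q :: real poly).
    zonoid Z \<and>
    (\<forall>t\<ge>0. measure lebesgue (Z + (*\<^sub>R) t ` cball 0 1) = poly P t) \<and>
    (\<forall>t\<ge>0. measure lebesgue ((*\<^sub>R) t ` Z + cball 0 1) = poly Q t) \<and>
    (\<exists>z::complex. poly (map_poly complex_of_real P) z = 0 \<and> z \<notin> \<real>) \<and>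
    (\<exists>w::complex. poly (map_poly complex_of_real Q) w = 0 \<and> w \<notin> \<real>)"
proof -
  define m where "m = CARD('n) - 2"
  have m: "DIM(real ^ 'n) = m + 2" "m > 0" "m \<ge> 1" using assms by (auto simp: m_def)
  have "\<not> card (Basis :: (real ^ 'n) set) \<le> 1" using m by simp
  then obtain a b :: "real ^ 'n" where ab: "a \<in> Basis" "b \<in> Basis" "a \<noteq> b"
    using card_le_Suc0_iff_eq[of "Basis :: (real ^ 'n) set"] by auto
  interpret orthonormal_pair a b
    using ab by unfold_locales (auto simp: inner_Basis)
  note volume = measure_disc_plus_cball[OF ab(1,2) m(1,2)]
  let ?A = "unit_ball_vol (m + 2)" and ?B = "pi * unit_ball_vol (m + 1)" and ?C = "pi * unit_ball_vol m"
  \<comment> \<open>Coefficients are listed from the constant term up, and \<open>m\<close>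
    applications of \<open>pCons 0\<close> multiply by t^m. \<open>Q\<close> has the coefficients of
    the quadratic factor of \<open>P\<close> in reverse order, so one discriminant governs
    both.\<close>
  define P where "P = (pCons 0 ^^ m) [:?C, ?B, ?A:]"
  define Q where "Q = [:?A, ?B, ?C:]"
  have "?B\<^sup>2 = pi * (pi * (unit_ball_vol (m + 1))\<^sup>2)" by (simp add: power2_eq_square)
  also have "\<dots> < pi * (4 * unit_ball_vol (m + 2) * unit_ball_vol m)"
    using pi_unit_ball_vol_square_less[OF m(3)] by (intro mult_strict_left_mono) auto
  finally have discr: "?B\<^sup>2 < 4 * ?A * ?C" "?B\<^sup>2 < 4 * ?C * ?A" by (simp_all add: mult_ac)
  have "measure lebesgue (disc + (*\<^sub>R) t ` cball 0 1) = poly P t" if "t \<ge> 0" for t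
    using volume[of 1 t] that
    by (simp add: P_def poly_pCons_0_funpow scaleR_image_cball_0_1 power2_eq_square algebra_simps)
  moreover have "measure lebesgue ((*\<^sub>R) t ` disc + cball 0 1) = poly Q t" if "t \<ge> 0" for t
    using volume[of t 1] that by (simp add: Q_def power2_eq_square algebra_simps)
  \<comment> \<open>A root of the quadratic factor is a root of \<open>P\<close>, whatever the power
    of t in front.\<close>
  moreover obtain z where "poly (map_poly complex_of_real [:?C, ?B, ?A:]) z = 0" "z \<notin> \<real>"
    using discr(1) by (rule nonreal_root_quadratic)
  then have "poly (map_poly complex_of_real P) z = 0" "z \<notin> \<real>"
    by (simp_all add: P_def map_poly_pCons_0_funpow poly_pCons_0_funpow)
  moreover obtain w where "poly (map_poly complex_of_real Q) w = 0" "w \<notin> \<real>"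
    using discr(2) unfolding Q_def by (rule nonreal_root_quadratic)
  ultimately show ?thesis using zonoid_disc by blast
qed

end
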